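(* Let $G$ be a finitely presented group and $N\trianglelefteq G$ a normal subgroup of finite index, so that $G$ can be written as a disjoint union $G=Nb_1\cup\cdots\cup Nb_m$, and let $K\subseteq G$. For $i\in\{1,\ldots,m\}$ write $L_i=(K\cap Nb_i)b_i^{-1}\subseteq N$. If for all $i\in\{1,\ldots,m\}$ and all $\varphi\in\mathrm{Via}(N)$ the subset $\varphi\text{-}\mathrm{TCC}_N(L_i)=\{(x^{-1}\varphi)sx\mid x\in N,\ s\in L_i\}$ is separable in $N$, then $\alpha(K)=\{x^{-1}sx\mid x\in G,\ s\in K\}$ is separable in $G$.
   Context: Maps are written on the right. The profinite topology on a group has as basis the cosets of finite index subgroups; a subset of a group is separable (in that group) if it is closed in the profinite topology of that group. $\mathrm{Via}(N)$ denotes the set of virtually inner automorphisms of $N$, i.e. automorphisms $\varphi$ such that $\varphi^k$ is inner for some $k>0$. *)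

theory Defs
  imports
    "HOL-Algebra.Bij"
    "HOL-Algebra.Coset"
    "HOL-Library.Disjoint_Sets"
    "HOL-Analysis.Abstract_Topology"
begin

section \<open>Free groups and finite presentations\<close>

text \<open>The letter \<open>(x, True)\<close> stands for the generator \<open>x\<close>, and \<open>(x, False)\<close> for its formal
  inverse.  Elements of the free group are the freely reduced words.\<close>

definition inv_letter :: "'x \<times> bool \<Rightarrow> 'x \<times> bool" where
  "inv_letter a = (fst a, \<not> snd a)"

definition reduced :: "('x \<times> bool) list \<Rightarrow> bool" where
  "reduced w \<longleftrightarrow> successively (\<lambda>a b. b \<noteq> inv_letter a) w"

text \<open>\<open>push a w\<close> is the free reduction of \<open>a # w\<close>, for reduced \<open>w\<close>.\<close>

definition push :: "'x \<times> bool \<Rightarrow> ('x \<times> bool) list \<Rightarrow> ('x \<times> bool) list" where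
  "push a w = (if w \<noteq> [] \<and> hd w = inv_letter a then tl w else a # w)"

definition free_group :: "'x set \<Rightarrow> ('x \<times> bool) list monoid" where
  "free_group X =
     \<lparr>carrier = {w. reduced w \<and> fst ` set w \<subseteq> X},
      mult = (\<lambda>u v. foldr push u v),
      one = []\<rparr>"

definition normal_closure :: "('a, 'b) monoid_scheme \<Rightarrow> 'a set \<Rightarrow> 'a set" where
  "normal_closure G R = \<Inter> {H. H \<lhd> G \<and> R \<subseteq> H}"

definition finitely_presented :: "('a, 'b) monoid_scheme \<Rightarrow> bool" where
  "finitely_presented G \<longleftrightarrow> group G \<and>
     (\<exists>(n::nat) R. finite R \<and> R \<subseteq> carrier (free_group {..<n}) \<and>
        G \<cong> free_group {..<n} Mod normal_closure (free_group {..<n}) R)"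

lemma inv_letter_inv_letter [simp]: "inv_letter (inv_letter a) = a"
  by (simp add: inv_letter_def)

lemma fst_inv_letter [simp]: "fst (inv_letter a) = fst a"
  by (simp add: inv_letter_def)

lemma inv_letter_neq [simp]: "inv_letter a \<noteq> a"
  by (cases a) (simp add: inv_letter_def)

lemma reduced_Nil [simp]: "reduced []"
  by (simp add: reduced_def)

lemma reduced_Cons:
  "reduced (a # w) \<longleftrightarrow> (w = [] \<or> hd w \<noteq> inv_letter a) \<and> reduced w"
  by (cases w) (auto simp: reduced_def)

lemma reduced_push: "reduced w \<Longrightarrow> reduced (push a w)"
  by (cases w) (auto simp: push_def reduced_Cons)

lemma push_inv_letter:
  assumes "reduced w"
  shows "push (inv_letter a) (push a w) = w"
  using assms by (cases w) (auto simp: push_def reduced_Cons)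

lemma reduced_foldr_push: "reduced v \<Longrightarrow> reduced (foldr push u v)"
  by (induction u) (auto simp: reduced_push)

lemma set_push: "set (push a w) \<subseteq> insert a (set w)"
  by (auto simp: push_def dest: list.set_sel(2))

lemma set_foldr_push: "set (foldr push u v) \<subseteq> set u \<union> set v"
  by (induction u) (use set_push in fastforce)+

lemma foldr_push_push:
  assumes "reduced w"
  shows "foldr push (push a u) w = push a (foldr push u w)"
proof (cases u)
  case (Cons b u')
  show ?thesis
  proof (cases "b = inv_letter a")
    case True
    then show ?thesis
      using Cons push_inv_letter[of "foldr push u' w" "inv_letter a"]
        reduced_foldr_push[OF assms] by (simp add: push_def)
  qed (simp add: Cons push_def)
qed (simp add: push_def)

lemma foldr_push_assoc:
  assumes "reduced w"
  shows "foldr push (foldr push u v) w = foldr push u (foldr push v w)"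
  by (induction u) (simp_all add: foldr_push_push[OF assms])

lemma foldr_push_reduced: "reduced w \<Longrightarrow> foldr push w [] = w"
  by (induction w) (auto simp: reduced_Cons push_def)

lemma foldr_push_inverse: "foldr push (rev (map inv_letter u)) (foldr push u v) = v"
  if "reduced v"
  by (induction u) (simp_all add: push_inv_letter reduced_foldr_push that)

lemma reduced_rev_inv: "reduced w \<Longrightarrow> reduced (rev (map inv_letter w))"
  unfolding reduced_def successively_rev successively_map
  by (erule successively_mono) (metis inv_letter_inv_letter)

lemma group_free_group: "group (free_group X)"
proof (rule groupI)
  fix u v
  assume "u \<in> carrier (free_group X)" "v \<in> carrier (free_group X)"
  then have "reduced v" "fst ` (set u \<union> set v) \<subseteq> X"
    by (auto simp: free_group_def)
  moreover have "fst ` set (foldr push u v) \<subseteq> fst ` (set u \<union> set v)"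
    by (intro image_mono set_foldr_push)
  ultimately show "u \<otimes>\<^bsub>free_group X\<^esub> v \<in> carrier (free_group X)"
    by (simp add: free_group_def reduced_foldr_push)
next
  fix u
  assume u: "u \<in> carrier (free_group X)"
  let ?v = "rev (map inv_letter u)"
  have "foldr push ?v u = []"
    using foldr_push_inverse[of "[]" u] foldr_push_reduced[of u] u
    by (simp add: free_group_def)
  moreover have "?v \<in> carrier (free_group X)"
    using u by (simp add: free_group_def reduced_rev_inv image_image)
  ultimately show "\<exists>v\<in>carrier (free_group X). v \<otimes>\<^bsub>free_group X\<^esub> u = \<one>\<^bsub>free_group X\<^esub>"
    by (intro bexI[of _ ?v]) (simp_all add: free_group_def)
qed (auto simp: free_group_def foldr_push_assoc)

lemma (in group) normal_closure_normal:
  assumes "R \<subseteq> carrier G"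
  shows "normal_closure G R \<lhd> G"
proof -
  have G: "carrier G \<in> {H. H \<lhd> G \<and> R \<subseteq> H}"
    using assms normal_inv_iff subgroup_self by auto
  have "subgroup (normal_closure G R) G"
    unfolding normal_closure_def
    using G by (intro subgroups_Inter) (auto simp: normal_inv_iff)
  moreover have "x \<otimes> h \<otimes> inv x \<in> normal_closure G R"
    if "x \<in> carrier G" "h \<in> normal_closure G R" for x h
    using that by (simp add: normal_closure_def normal_inv_iff)
  ultimately show ?thesis
    by (simp add: normal_inv_iff)
qed

section \<open>The profinite topology\<close>

definition finite_index_cosets :: "('a, 'b) monoid_scheme \<Rightarrow> 'a set set" where
  "finite_index_cosets G =
     {C. \<exists>H. subgroup H G \<and> finite (rcosets\<^bsub>G\<^esub> H) \<and> C \<in> rcosets\<^bsub>G\<^esub> H}"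

text \<open>Right cosets suffice: the left coset \<open>x <# H\<close> is a right coset of the conjugate
  of \<open>H\<close> by \<open>x\<close>, which has the same index.\<close>

definition profinite_topology :: "('a, 'b) monoid_scheme \<Rightarrow> 'a topology" where
  "profinite_topology G = topology (arbitrary union_of (\<lambda>C. C \<in> finite_index_cosets G))"

definition separable :: "('a, 'b) monoid_scheme \<Rightarrow> 'a set \<Rightarrow> bool" where
  "separable G S \<longleftrightarrow> closedin (profinite_topology G) S"

lemma (in group) rcoset_Int:
  assumes "subgroup H G" "subgroup K G" "x \<in> carrier G"
  shows "(H \<inter> K) #> x = (H #> x) \<inter> (K #> x)"
proof -
  have "H \<subseteq> carrier G" "K \<subseteq> carrier G"
    using assms subgroup.subset by auto
  then have "inj_on (\<lambda>h. h \<otimes> x) (H \<union> K)"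
    using inj_on_multc[OF assms(3)] by (meson inj_on_subset Un_least)
  then have "(\<lambda>h. h \<otimes> x) ` (H \<inter> K) = (\<lambda>h. h \<otimes> x) ` H \<inter> (\<lambda>h. h \<otimes> x) ` K"
    by (rule inj_on_image_Int) simp_all
  then show ?thesis
    unfolding r_coset_def UNION_singleton_eq_range .
qed

lemma (in group) finite_rcosets_Int:
  assumes "subgroup H G" "subgroup K G" "finite (rcosets H)" "finite (rcosets K)"
  shows "finite (rcosets (H \<inter> K))"
proof (rule finite_subset)
  show "rcosets (H \<inter> K) \<subseteq> (\<lambda>(A, B). A \<inter> B) ` ((rcosets H) \<times> (rcosets K))"
  proof
    fix C
    assume "C \<in> rcosets (H \<inter> K)"
    then obtain x where x: "x \<in> carrier G" "C = (H \<inter> K) #> x"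
      by (auto simp: RCOSETS_def)
    then have "C = (\<lambda>(A, B). A \<inter> B) (H #> x, K #> x)"
      by (simp add: rcoset_Int[OF assms(1,2)])
    moreover have "(H #> x, K #> x) \<in> (rcosets H) \<times> (rcosets K)"
      using x(1) by (auto simp: RCOSETS_def)
    ultimately show "C \<in> (\<lambda>(A, B). A \<inter> B) ` ((rcosets H) \<times> (rcosets K))"
      by (rule image_eqI)
  qed
  show "finite ((\<lambda>(A, B). A \<inter> B) ` ((rcosets H) \<times> (rcosets K)))"
    by (intro finite_imageI finite_cartesian_product assms)
qed

lemma (in group) openin_profinite_topology:
  "openin (profinite_topology G) = arbitrary union_of (\<lambda>C. C \<in> finite_index_cosets G)"
proof -
  have "(arbitrary union_of (\<lambda>C. C \<in> finite_index_cosets G)) (S \<inter> T)"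
    if ST: "S \<in> finite_index_cosets G" "T \<in> finite_index_cosets G" for S T
  proof -
    from ST obtain H K where H: "subgroup H G" "finite (rcosets H)" "S \<in> rcosets H"
      and K: "subgroup K G" "finite (rcosets K)" "T \<in> rcosets K"
      by (auto simp: finite_index_cosets_def)
    show ?thesis
    proof (cases "S \<inter> T = {}")
      case False
      then obtain z where z: "z \<in> S" "z \<in> T" by auto
      then have zG: "z \<in> carrier G"
        using H rcosets_part_G by blast
      have "H #> z = S"
        using H(3) z(1) repr_independence[OF _ _ H(1)] unfolding RCOSETS_def by blast
      moreover have "K #> z = T"
        using K(3) z(2) repr_independence[OF _ _ K(1)] unfolding RCOSETS_def by blast
      ultimately have "S \<inter> T = (H \<inter> K) #> z"
        using rcoset_Int[OF H(1) K(1) zG] by simp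
      then have "S \<inter> T \<in> rcosets (H \<inter> K)"
        using zG unfolding RCOSETS_def by blast
      then show ?thesis
        using finite_rcosets_Int[OF H(1) K(1) H(2) K(2)] subgroups_Inter_pair[OF H(1) K(1)]
        by (intro arbitrary_union_of_inc) (auto simp: finite_index_cosets_def)
    qed simp
  qed
  then have "istopology (arbitrary union_of (\<lambda>C. C \<in> finite_index_cosets G))"
    by (simp add: istopology_base_eq)
  then show ?thesis
    unfolding profinite_topology_def by (rule topology_inverse')
qed

lemma (in group) topspace_profinite_topology: "topspace (profinite_topology G) = carrier G"
proof -
  have "carrier G #> x = carrier G" if "x \<in> carrier G" for x
    using that coset_join2 subgroup_self by blast
  then have "rcosets (carrier G) = {carrier G}"
    unfolding RCOSETS_def using one_closed by blast
  then have "carrier G \<in> finite_index_cosets G"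
    unfolding finite_index_cosets_def using subgroup_self by force
  then have "openin (profinite_topology G) (carrier G)"
    unfolding openin_profinite_topology by (rule arbitrary_union_of_inc)
  moreover have "U \<subseteq> carrier G" if "openin (profinite_topology G) U" for U
  proof -
    have "\<exists>\<U>. \<U> \<subseteq> finite_index_cosets G \<and> \<Union>\<U> = U"
      using that by (simp add: openin_profinite_topology union_of_def arbitrary_def)
    then obtain \<U> where "\<U> \<subseteq> finite_index_cosets G" "U = \<Union>\<U>"
      by auto
    moreover have "C \<subseteq> carrier G" if C: "C \<in> finite_index_cosets G" for C
    proof -
      obtain H where "subgroup H G" "C \<in> rcosets H"
        using C by (auto simp: finite_index_cosets_def)
      then show ?thesis
        using rcosets_part_G[of H] by auto
    qed
    ultimately show ?thesis by blast
  qed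
  ultimately show ?thesis
    unfolding topspace_def by blast
qed

section \<open>Virtually inner automorphisms and conjugacy closures\<close>

definition inner_automorphisms :: "('a, 'b) monoid_scheme \<Rightarrow> ('a \<Rightarrow> 'a) set" where
  "inner_automorphisms G =
     {\<lambda>x\<in>carrier G. inv\<^bsub>G\<^esub> g \<otimes>\<^bsub>G\<^esub> x \<otimes>\<^bsub>G\<^esub> g | g. g \<in> carrier G}"

definition Via :: "('a, 'b) monoid_scheme \<Rightarrow> ('a \<Rightarrow> 'a) set" where
  "Via G = {\<phi> \<in> carrier (AutoGroup G).
     \<exists>k::nat. k > 0 \<and> \<phi> [^]\<^bsub>AutoGroup G\<^esub> k \<in> inner_automorphisms G}"

definition TCC :: "('a, 'b) monoid_scheme \<Rightarrow> ('a \<Rightarrow> 'a) \<Rightarrow> 'a set \<Rightarrow> 'a set" where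
  "TCC G \<phi> S = {\<phi> (inv\<^bsub>G\<^esub> x) \<otimes>\<^bsub>G\<^esub> s \<otimes>\<^bsub>G\<^esub> x | x s. x \<in> carrier G \<and> s \<in> S}"

definition conj_closure :: "('a, 'b) monoid_scheme \<Rightarrow> 'a set \<Rightarrow> 'a set" where
  "conj_closure G S = {inv\<^bsub>G\<^esub> x \<otimes>\<^bsub>G\<^esub> s \<otimes>\<^bsub>G\<^esub> x | x s. x \<in> carrier G \<and> s \<in> S}"

end

theory Submission
  imports Defs "HOL-Algebra.Group_Action"
begin

text \<open>
  Everything rests on one substitution.  For \<open>c\<close> in \<open>G\<close> and \<open>s\<close>, \<open>n\<close> in \<open>N\<close>, put
  \<open>x = c n c\<^sup>-\<^sup>1\<close>; then \<open>n\<^sup>-\<^sup>1 (s c) n = (c\<^sup>-\<^sup>1 x\<^sup>-\<^sup>1 c) s x c\<close>.  So the \<open>N\<close>-conjugates of \<open>L c\<close>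
  form the right translate by \<open>c\<close> of the twisted conjugacy closure of \<open>L\<close>, the twist being
  \<open>y \<mapsto> c\<^sup>-\<^sup>1 y c\<close> on \<open>N\<close> (\<open>conjugates_by_normal_eq_TCC\<close>).  This automorphism is virtually inner:
  some positive power of \<open>c\<close> lies in \<open>N\<close>, because \<open>N\<close> has finite index
  (\<open>conj_restrict_in_Via\<close>).

  Write a conjugating element of \<open>G\<close> as \<open>n b\<^sub>j\<close> and split \<open>K\<close> into the pieces \<open>L\<^sub>i b\<^sub>i\<close>.  Then the
  conjugacy closure of \<open>K\<close> is a union of \<open>m\<^sup>2\<close> sets, each a two-sided translate in \<open>G\<close> of a
  twisted conjugacy closure in \<open>N\<close>.  The latter are separable in \<open>N\<close> by hypothesis.  They are
  separable in \<open>G\<close> too, since \<open>N\<close> is open and closed in \<open>G\<close> and its profinite topology is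
  no finer than the induced one (\<open>separable_finite_index_subgroup\<close>); and translations are
  homeomorphisms (\<open>separable_translate\<close>).  A finite union of closed sets is closed.
\<close>

section \<open>The profinite topology under translation and passage to finite index\<close>

lemma (in group) inv_mult_cancel:
  assumes "a \<in> carrier G" "z \<in> carrier G"
  shows "inv a \<otimes> (a \<otimes> z) = z" "a \<otimes> (inv a \<otimes> z) = z"
  using assms by (simp_all add: m_assoc[symmetric])

lemma (in group) separable_iff:
  "separable G S \<longleftrightarrow> S \<subseteq> carrier G \<and> openin (profinite_topology G) (carrier G - S)"
  by (simp add: separable_def closedin_def topspace_profinite_topology)

lemma (in group) openin_finite_index_coset:
  "C \<in> finite_index_cosets G \<Longrightarrow> openin (profinite_topology G) C"
  by (simp add: openin_profinite_topology arbitrary_union_of_inc)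

lemma (in group) openin_profinite_UnionE:
  assumes "openin (profinite_topology G) U"
  obtains \<U> where "\<U> \<subseteq> finite_index_cosets G" "U = \<Union>\<U>"
  using assms that unfolding openin_profinite_topology union_of_def arbitrary_def by auto

lemma (in group) translate_rcoset:
  assumes "H \<subseteq> carrier G" "a \<in> carrier G" "c \<in> carrier G" "x \<in> carrier G"
  shows "(\<lambda>z. a \<otimes> z \<otimes> c) ` (H #> x) = (a <# H #> inv a) #> (a \<otimes> x \<otimes> c)"
proof -
  have "a \<otimes> (h \<otimes> x) \<otimes> c = a \<otimes> h \<otimes> inv a \<otimes> (a \<otimes> x \<otimes> c)" if "h \<in> H" for h
    using assms that by (simp add: m_assoc subset_iff inv_mult_cancel)
  then show ?thesis
    unfolding r_coset_def l_coset_def by (force simp: image_iff)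
qed

text \<open>The left factor \<open>a\<close> moves a right coset of \<open>H\<close> to a right coset of the conjugate
  \<open>a H a\<^sup>-\<^sup>1\<close>.  The cosets of this conjugate are translates of those of \<open>H\<close>, so the index stays
  finite.\<close>

lemma (in group) finite_index_coset_translate:
  assumes C: "C \<in> finite_index_cosets G" and a: "a \<in> carrier G" and c: "c \<in> carrier G"
  shows "(\<lambda>z. a \<otimes> z \<otimes> c) ` C \<in> finite_index_cosets G"
proof -
  from C obtain H x where H: "subgroup H G" "finite (rcosets H)"
    and x: "x \<in> carrier G" "C = H #> x"
    by (auto simp: finite_index_cosets_def RCOSETS_def)
  let ?H' = "a <# H #> inv a"
  have H': "subgroup ?H' G"
    using subgroup_conjugation_is_surj1[of "inv a" H] a H by simp
  have Hsub: "H \<subseteq> carrier G"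
    using H subgroup.subset by blast
  have "rcosets ?H' \<subseteq> (\<lambda>D. (\<lambda>z. a \<otimes> z \<otimes> \<one>) ` D) ` (rcosets H)"
  proof
    fix D
    assume "D \<in> rcosets ?H'"
    then obtain y where y: "y \<in> carrier G" "D = ?H' #> y"
      by (auto simp: RCOSETS_def)
    have "D = (\<lambda>z. a \<otimes> z \<otimes> \<one>) ` (H #> (inv a \<otimes> y))"
      using translate_rcoset[OF Hsub a one_closed, of "inv a \<otimes> y"] a y
      by (simp add: m_assoc[symmetric])
    then show "D \<in> (\<lambda>D. (\<lambda>z. a \<otimes> z \<otimes> \<one>) ` D) ` (rcosets H)"
      using rcosetsI[OF Hsub, of "inv a \<otimes> y"] a y by simp
  qed
  then have "finite (rcosets ?H')"
    using H(2) finite_surj by blast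
  moreover have "(\<lambda>z. a \<otimes> z \<otimes> c) ` C \<in> rcosets ?H'"
    using translate_rcoset[OF Hsub a c x(1)] x a c
    by (simp add: rcosetsI[OF subgroup.subset[OF H']])
  ultimately show ?thesis
    using H' by (auto simp: finite_index_cosets_def)
qed

lemma (in group) translate_bij:
  assumes "a \<in> carrier G" "c \<in> carrier G"
  shows "bij_betw (\<lambda>z. a \<otimes> z \<otimes> c) (carrier G) (carrier G)"
proof (rule bij_betw_byWitness[where f' = "\<lambda>z. inv a \<otimes> z \<otimes> inv c"])
  show "\<forall>z\<in>carrier G. inv a \<otimes> (a \<otimes> z \<otimes> c) \<otimes> inv c = z"
    using assms by (simp add: m_assoc inv_mult_cancel)
  show "\<forall>z\<in>carrier G. a \<otimes> (inv a \<otimes> z \<otimes> inv c) \<otimes> c = z"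
    using assms by (simp add: m_assoc inv_mult_cancel)
qed (use assms in auto)

lemma (in group) separable_translate:
  assumes S: "separable G S" and ac: "a \<in> carrier G" "c \<in> carrier G"
  shows "separable G ((\<lambda>z. a \<otimes> z \<otimes> c) ` S)"
proof -
  let ?t = "\<lambda>z. a \<otimes> z \<otimes> c"
  have t: "inj_on ?t (carrier G)" "?t ` carrier G = carrier G"
    using translate_bij[OF ac] by (auto simp: bij_betw_def)
  have sub: "S \<subseteq> carrier G" and op: "openin (profinite_topology G) (carrier G - S)"
    using S by (auto simp: separable_iff)
  from op obtain \<U> where \<U>: "\<U> \<subseteq> finite_index_cosets G" "carrier G - S = \<Union>\<U>"
    by (rule openin_profinite_UnionE)
  have "carrier G - ?t ` S = ?t ` (carrier G - S)"
    using inj_on_image_set_diff[OF t(1) Diff_subset sub] t(2) by simp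
  also have "\<dots> = (\<Union>C\<in>\<U>. ?t ` C)"
    unfolding \<U>(2) by blast
  also have "openin (profinite_topology G) \<dots>"
    using \<U>(1) ac
    by (intro openin_Union) (auto intro: openin_finite_index_coset finite_index_coset_translate)
  finally show ?thesis
    using sub ac by (auto simp: separable_iff)
qed

text \<open>Finiteness of index is transitive: with a finite set \<open>T\<close> of representatives for the cosets
  of \<open>N\<close> in \<open>G\<close>, every coset of \<open>H\<close> in \<open>G\<close> has the form \<open>D t\<close> with \<open>D\<close> a coset of \<open>H\<close> in \<open>N\<close> and
  \<open>t\<close> in \<open>T\<close>.\<close>

lemma (in group) finite_index_coset_of_subgroup:
  assumes N: "subgroup N G" "finite (rcosets N)"
    and C: "C \<in> finite_index_cosets (G\<lparr>carrier := N\<rparr>)"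
  shows "C \<in> finite_index_cosets G"
proof -
  from C obtain H where HN: "subgroup H (G\<lparr>carrier := N\<rparr>)"
    and fin: "finite (rcosets\<^bsub>G\<lparr>carrier := N\<rparr>\<^esub> H)" and CH: "C \<in> rcosets\<^bsub>G\<lparr>carrier := N\<rparr>\<^esub> H"
    by (auto simp: finite_index_cosets_def)
  have H: "subgroup H G"
    using incl_subgroup[OF N(1) HN] .
  have Nsub: "N \<subseteq> carrier G" and Hsub: "H \<subseteq> carrier G"
    using N(1) H subgroup.subset by blast+
  have coset_eq: "rcosets\<^bsub>G\<lparr>carrier := N\<rparr>\<^esub> H = {H #> n | n. n \<in> N}"
    by (auto simp: RCOSETS_def r_coset_def)
  define T where "T = (\<lambda>A. SOME t. t \<in> A) ` (rcosets N)"
  have "rcosets H \<subseteq> (\<lambda>(D, t). D #> t) ` ((rcosets\<^bsub>G\<lparr>carrier := N\<rparr>\<^esub> H) \<times> T)"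
  proof
    fix D
    assume "D \<in> rcosets H"
    then obtain g where g: "g \<in> carrier G" "D = H #> g"
      by (auto simp: RCOSETS_def)
    define t where "t = (SOME t. t \<in> N #> g)"
    have "t \<in> N #> g"
      unfolding t_def using rcos_self[OF g(1) N(1)] by (rule someI)
    then have tG: "t \<in> carrier G" and "N #> g = N #> t"
      using repr_independence[OF _ g(1) N(1)] r_coset_subset_G[OF Nsub g(1)] by blast+
    then obtain n where n: "n \<in> N" "g = n \<otimes> t"
      using rcos_self[OF g(1) N(1)] by (auto simp: r_coset_def)
    have "D = (H #> n) #> t"
      using g(2) n tG Hsub Nsub by (simp add: coset_mult_assoc subset_iff)
    moreover have "t \<in> T"
      unfolding T_def t_def using rcosetsI[OF Nsub g(1)] by blast
    ultimately show "D \<in> (\<lambda>(D, t). D #> t) ` ((rcosets\<^bsub>G\<lparr>carrier := N\<rparr>\<^esub> H) \<times> T)"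
      using n(1) by (intro image_eqI[of _ _ "(H #> n, t)"]) (auto simp: coset_eq)
  qed
  moreover have "finite T"
    unfolding T_def using N(2) by blast
  ultimately have "finite (rcosets H)"
    using fin finite_surj finite_cartesian_product by metis
  moreover have "C \<in> rcosets H"
    using CH Nsub by (auto simp: coset_eq intro: rcosetsI[OF Hsub])
  ultimately show ?thesis
    using H by (auto simp: finite_index_cosets_def)
qed

lemma (in group) openin_finite_index_subgroup:
  assumes N: "subgroup N G" "finite (rcosets N)"
    and U: "openin (profinite_topology (G\<lparr>carrier := N\<rparr>)) U"
  shows "openin (profinite_topology G) U"
proof -
  interpret N: group "G\<lparr>carrier := N\<rparr>"
    using subgroup_imp_group[OF N(1)] .
  from U obtain \<U> where "\<U> \<subseteq> finite_index_cosets (G\<lparr>carrier := N\<rparr>)" "U = \<Union>\<U>"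
    by (rule N.openin_profinite_UnionE)
  then show ?thesis
    using finite_index_coset_of_subgroup[OF N] openin_finite_index_coset
    by (metis openin_Union subsetD)
qed

text \<open>The complement of \<open>S\<close> in \<open>G\<close> consists of its complement in \<open>N\<close>, which is open, and the
  cosets of \<open>N\<close> other than \<open>N\<close>.\<close>

lemma (in group) separable_finite_index_subgroup:
  assumes N: "subgroup N G" "finite (rcosets N)"
    and S: "separable (G\<lparr>carrier := N\<rparr>) S"
  shows "separable G S"
proof -
  interpret N: group "G\<lparr>carrier := N\<rparr>"
    using subgroup_imp_group[OF N(1)] .
  have SN: "S \<subseteq> N" and op: "openin (profinite_topology (G\<lparr>carrier := N\<rparr>)) (N - S)"
    using S by (auto simp: N.separable_iff)
  have Nsub: "N \<subseteq> carrier G"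
    using N(1) subgroup.subset by blast
  have N_coset: "N \<in> rcosets N"
    using subgroup.subgroup_in_rcosets[OF N(1) is_group] .
  have "\<Union>(rcosets N - {N}) = carrier G - N"
  proof -
    have "A \<inter> N = {}" if "A \<in> rcosets N - {N}" for A
      using that N_coset rcos_disjoint[OF N(1)] by (auto simp: pairwise_def disjnt_def)
    then have "N \<inter> \<Union>(rcosets N - {N}) = {}"
      by fastforce
    moreover have "carrier G = N \<union> \<Union>(rcosets N - {N})"
      unfolding rcosets_part_G[OF N(1), symmetric] Union_insert[symmetric] insert_Diff[OF N_coset] ..
    ultimately show ?thesis
      by (simp add: Un_Diff Diff_triv Int_commute)
  qed
  then have "carrier G - S = (N - S) \<union> \<Union>(rcosets N - {N})"
    using SN Nsub by blast
  moreover have "openin (profinite_topology G) (\<Union>(rcosets N - {N}))"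
    using N by (intro openin_Union openin_finite_index_coset) (auto simp: finite_index_cosets_def)
  ultimately show ?thesis
    using openin_finite_index_subgroup[OF N op] SN Nsub by (auto simp: separable_iff)
qed

section \<open>Conjugation restricted to a normal subgroup of finite index\<close>

text \<open>Two of the powers of \<open>x\<close> lie in the same coset, by the pigeonhole principle; the
  difference of their exponents serves as \<open>k\<close>.\<close>

lemma (in group) pow_in_finite_index_subgroup:
  assumes N: "subgroup N G" "finite (rcosets N)" and x: "x \<in> carrier G"
  obtains k :: nat where "k > 0" "x [^] k \<in> N"
proof -
  have Nsub: "N \<subseteq> carrier G"
    using N(1) subgroup.subset by blast
  have "range (\<lambda>k::nat. N #> x [^] k) \<subseteq> rcosets N"
    using x by (auto intro: rcosetsI[OF Nsub])
  then have "finite (range (\<lambda>k::nat. N #> x [^] k))"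
    using N(2) finite_subset by blast
  then have "\<not> inj (\<lambda>k::nat. N #> x [^] k)"
    using finite_imageD infinite_UNIV_nat by blast
  then obtain i j :: nat where ij: "i < j" "N #> x [^] i = N #> x [^] j"
    unfolding inj_on_def by (metis nat_neq_iff)
  have "N #> x [^] (j - i) #> x [^] i = N #> x [^] i"
    using ij x by (simp add: coset_mult_assoc[OF Nsub] nat_pow_mult)
  then have "N #> x [^] (j - i) #> x [^] i #> inv (x [^] i) = N #> x [^] i #> inv (x [^] i)"
    by simp
  then have "N #> x [^] (j - i) = N"
    using x Nsub by (simp add: coset_mult_assoc m_assoc)
  then have "x [^] (j - i) \<in> N"
    using coset_join1[OF _ _ N(1)] x by blast
  with ij(1) that show ?thesis by (meson zero_less_diff)
qed

text \<open>Functions in the automorphism group are extensional, hence the restriction to \<open>N\<close>.\<close>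

definition conj_restrict :: "('a, 'b) monoid_scheme \<Rightarrow> 'a set \<Rightarrow> 'a \<Rightarrow> 'a \<Rightarrow> 'a" where
  "conj_restrict G N c = (\<lambda>x\<in>N. inv\<^bsub>G\<^esub> c \<otimes>\<^bsub>G\<^esub> x \<otimes>\<^bsub>G\<^esub> c)"

context normal
begin

lemma conj_restrict_in_auto:
  assumes c: "c \<in> carrier G"
  shows "conj_restrict G H c \<in> auto (G\<lparr>carrier := H\<rparr>)"
proof -
  have "bij_betw (conj_restrict G H c) H H"
    unfolding conj_restrict_def
  proof (rule bij_betw_byWitness[where f' = "\<lambda>z. c \<otimes> z \<otimes> inv c"])
    show "\<forall>z\<in>H. c \<otimes> (\<lambda>x\<in>H. inv c \<otimes> x \<otimes> c) z \<otimes> inv c = z"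
      using c by (simp add: m_assoc inv_mult_cancel)
    show "\<forall>z\<in>H. (\<lambda>x\<in>H. inv c \<otimes> x \<otimes> c) (c \<otimes> z \<otimes> inv c) = z"
      using c by (simp add: inv_op_closed2) (simp add: m_assoc inv_mult_cancel)
  qed (use c in \<open>auto simp: inv_op_closed1 inv_op_closed2\<close>)
  moreover have "inv c \<otimes> (x \<otimes> y) \<otimes> c = inv c \<otimes> x \<otimes> c \<otimes> (inv c \<otimes> y \<otimes> c)"
    if "x \<in> H" "y \<in> H" for x y
    using c that by (simp add: m_assoc inv_mult_cancel)
  ultimately show ?thesis
    using c by (auto simp: auto_def Bij_def hom_def conj_restrict_def inv_op_closed1)
qed

lemma conj_restrict_pow:
  fixes k :: nat
  assumes c: "c \<in> carrier G"
  shows "conj_restrict G H c [^]\<^bsub>AutoGroup (G\<lparr>carrier := H\<rparr>)\<^esub> k = conj_restrict G H (c [^] k)"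
proof (induction k)
  case 0
  show ?case
    by (auto simp: AutoGroup_def BijGroup_def conj_restrict_def)
next
  case (Suc k)
  have Bij: "conj_restrict G H d \<in> Bij H" if "d \<in> carrier G" for d
    using conj_restrict_in_auto[OF that] by (simp add: auto_def)
  \<comment> \<open>The new conjugation by \<open>c\<close> is applied first, so the exponents combine to \<open>c c\<^sup>k\<close>, whereas
    powers are defined by \<open>c\<^sup>k c\<close>.\<close>
  have "inv (c [^] k) \<otimes> (inv c \<otimes> x \<otimes> c) \<otimes> c [^] k = inv (c [^] Suc k) \<otimes> x \<otimes> c [^] Suc k"
    if "x \<in> H" for x
    using c that nat_pow_Suc2[OF c, of k]
    by (simp add: inv_mult_group m_assoc del: nat_pow_Suc)
  then have "compose H (conj_restrict G H (c [^] k)) (conj_restrict G H c)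
      = conj_restrict G H (c [^] Suc k)"
    using c by (auto simp: compose_def conj_restrict_def inv_op_closed1 simp del: nat_pow_Suc
        intro!: restrict_ext)
  moreover have "f \<otimes>\<^bsub>AutoGroup (G\<lparr>carrier := H\<rparr>)\<^esub> g = compose H f g"
    if "f \<in> Bij H" "g \<in> Bij H" for f g
    using that by (simp add: AutoGroup_def BijGroup_def)
  moreover have "conj_restrict G H c [^]\<^bsub>AutoGroup (G\<lparr>carrier := H\<rparr>)\<^esub> Suc k
      = conj_restrict G H (c [^] k) \<otimes>\<^bsub>AutoGroup (G\<lparr>carrier := H\<rparr>)\<^esub> conj_restrict G H c"
    using Suc by (simp add: nat_pow_def)
  ultimately show ?case
    using Bij c by simp
qed

lemma conj_restrict_in_Via:
  assumes fin: "finite (rcosets H)" and c: "c \<in> carrier G"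
  shows "conj_restrict G H c \<in> Via (G\<lparr>carrier := H\<rparr>)"
proof -
  obtain k :: nat where k: "k > 0" "c [^] k \<in> H"
    using pow_in_finite_index_subgroup[OF subgroup_axioms fin c] .
  have "conj_restrict G H (c [^] k) \<in> inner_automorphisms (G\<lparr>carrier := H\<rparr>)"
    unfolding inner_automorphisms_def conj_restrict_def
    using k(2) m_inv_consistent[OF subgroup_axioms k(2)] by (auto intro!: exI[of _ "c [^] k"])
  then show ?thesis
    using k(1) conj_restrict_in_auto[OF c] conj_restrict_pow[OF c, of k]
    by (auto simp: Via_def AutoGroup_def)
qed

text \<open>The two parametrisations correspond under \<open>x = c n c\<^sup>-\<^sup>1\<close>; normality makes this a bijection
  of the subgroup.\<close>

lemma conjugates_by_normal_eq_TCC: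
  assumes L: "L \<subseteq> H" and c: "c \<in> carrier G"
  shows "{inv n \<otimes> (s \<otimes> c) \<otimes> n | n s. n \<in> H \<and> s \<in> L}
    = TCC (G\<lparr>carrier := H\<rparr>) (conj_restrict G H c) L #> c"
proof -
  have TCC_eq: "TCC (G\<lparr>carrier := H\<rparr>) (conj_restrict G H c) L
      = {inv c \<otimes> inv x \<otimes> c \<otimes> s \<otimes> x | x s. x \<in> H \<and> s \<in> L}"
    unfolding TCC_def conj_restrict_def
    by (rule Collect_cong) (force simp: m_inv_consistent[OF subgroup_axioms])
  have key: "inv n \<otimes> (s \<otimes> c) \<otimes> n = inv c \<otimes> inv (c \<otimes> n \<otimes> inv c) \<otimes> c \<otimes> s \<otimes> (c \<otimes> n \<otimes> inv c) \<otimes> c"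
    if "n \<in> H" "s \<in> carrier G" for n s
    using that c by (simp add: m_assoc inv_mult_group inv_mult_cancel)
  have sG: "s \<in> carrier G" if "s \<in> L" for s
    using that L by auto
  show ?thesis
  proof (intro equalityI subsetI)
    fix z
    assume "z \<in> {inv n \<otimes> (s \<otimes> c) \<otimes> n | n s. n \<in> H \<and> s \<in> L}"
    then obtain n s where ns: "n \<in> H" "s \<in> L" "z = inv n \<otimes> (s \<otimes> c) \<otimes> n"
      by blast
    have "inv c \<otimes> inv (c \<otimes> n \<otimes> inv c) \<otimes> c \<otimes> s \<otimes> (c \<otimes> n \<otimes> inv c)
        \<in> TCC (G\<lparr>carrier := H\<rparr>) (conj_restrict G H c) L"
      unfolding TCC_eq using ns(2) inv_op_closed2[OF c ns(1)] by blast
    then show "z \<in> TCC (G\<lparr>carrier := H\<rparr>) (conj_restrict G H c) L #> c"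
      unfolding ns(3) key[OF ns(1) sG[OF ns(2)]] r_coset_def by blast
  next
    fix z
    assume "z \<in> TCC (G\<lparr>carrier := H\<rparr>) (conj_restrict G H c) L #> c"
    then obtain x s where xs: "x \<in> H" "s \<in> L" "z = inv c \<otimes> inv x \<otimes> c \<otimes> s \<otimes> x \<otimes> c"
      unfolding TCC_eq r_coset_def by blast
    define n where "n = inv c \<otimes> x \<otimes> c"
    have n: "n \<in> H" "c \<otimes> n \<otimes> inv c = x"
      unfolding n_def using xs(1) c inv_op_closed1[OF c] by (auto simp: conjugation_is_surj)
    then have "z = inv n \<otimes> (s \<otimes> c) \<otimes> n"
      using key[OF n(1) sG[OF xs(2)]] xs(3) by simp
    then show "z \<in> {inv n \<otimes> (s \<otimes> c) \<otimes> n | n s. n \<in> H \<and> s \<in> L}"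
      using n(1) xs(2) by blast
  qed
qed

end

section \<open>Decomposition of the conjugacy closure\<close>

text \<open>Conjugation by \<open>n b\<^sub>j\<close> is conjugation by \<open>n\<close> followed by conjugation by \<open>b\<^sub>j\<close>.  The first turns
  the piece of \<open>K\<close> in the coset of \<open>b\<^sub>i\<close> into a twisted conjugacy closure translated by \<open>b\<^sub>i\<close>; this
  translation and the conjugation by \<open>b\<^sub>j\<close> merge into one two-sided translation.\<close>

lemma (in normal) conj_closure_eq_Union_TCC:
  assumes b: "\<And>i. i \<in> I \<Longrightarrow> b i \<in> carrier G"
    and cover: "carrier G = (\<Union>i\<in>I. H #> b i)"
    and K: "K \<subseteq> carrier G"
  defines "L \<equiv> \<lambda>i. (K \<inter> (H #> b i)) #> inv (b i)"
  shows "conj_closure G K = (\<Union>i\<in>I. \<Union>j\<in>I. (\<lambda>z. inv (b j) \<otimes> z \<otimes> (b i \<otimes> b j)) `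
    TCC (G\<lparr>carrier := H\<rparr>) (conj_restrict G H (b i)) (L i))"
proof -
  have LH: "L i \<subseteq> H" if "i \<in> I" for i
    using b[OF that] by (auto simp: L_def r_coset_def m_assoc)
  have L_shift: "L i #> b i = K \<inter> (H #> b i)" if "i \<in> I" for i
    using b[OF that] K by (simp add: L_def coset_mult_assoc le_infI1)
  have TCC_sub: "TCC (G\<lparr>carrier := H\<rparr>) (conj_restrict G H (b i)) (L i) \<subseteq> carrier G"
    if "i \<in> I" for i
    using LH[OF that] b[OF that]
    by (force simp: TCC_def conj_restrict_def m_inv_consistent[OF subgroup_axioms]
        inv_op_closed1)
  have piece: "{inv n \<otimes> t \<otimes> n | n t. n \<in> H \<and> t \<in> K \<inter> (H #> b i)}
      = TCC (G\<lparr>carrier := H\<rparr>) (conj_restrict G H (b i)) (L i) #> b i" if i: "i \<in> I" for i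
    unfolding conjugates_by_normal_eq_TCC[OF LH[OF i] b[OF i], symmetric] L_shift[OF i, symmetric]
    by (auto simp: r_coset_def)
  have "conj_closure G K = (\<Union>i\<in>I. \<Union>j\<in>I. (\<lambda>w. inv (b j) \<otimes> w \<otimes> b j) `
      {inv n \<otimes> t \<otimes> n | n t. n \<in> H \<and> t \<in> K \<inter> (H #> b i)})" (is "_ = ?R")
  proof (intro equalityI subsetI)
    fix z
    assume "z \<in> conj_closure G K"
    then obtain x t where x: "x \<in> carrier G" and t: "t \<in> K" and z: "z = inv x \<otimes> t \<otimes> x"
      by (auto simp: conj_closure_def)
    obtain i where i: "i \<in> I" "t \<in> H #> b i"
      using t K cover by blast
    obtain j n where j: "j \<in> I" "n \<in> H" "x = n \<otimes> b j"
      using x cover by (auto simp: r_coset_def)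
    have "z = inv (b j) \<otimes> (inv n \<otimes> t \<otimes> n) \<otimes> b j"
      using z j t K b by (auto simp: inv_mult_group m_assoc subset_iff)
    then show "z \<in> ?R"
      using i j t by blast
  next
    fix z
    assume "z \<in> ?R"
    then obtain j n t where j: "j \<in> I" "n \<in> H" and t: "t \<in> K"
      and z: "z = inv (b j) \<otimes> (inv n \<otimes> t \<otimes> n) \<otimes> b j"
      by auto
    have "z = inv (n \<otimes> b j) \<otimes> t \<otimes> (n \<otimes> b j)" "n \<otimes> b j \<in> carrier G"
      using z j t K b by (auto simp: inv_mult_group m_assoc subset_iff)
    then show "z \<in> conj_closure G K"
      using t by (auto simp: conj_closure_def)
  qed
  also have "\<dots> = (\<Union>i\<in>I. \<Union>j\<in>I. (\<lambda>z. inv (b j) \<otimes> z \<otimes> (b i \<otimes> b j)) `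
      TCC (G\<lparr>carrier := H\<rparr>) (conj_restrict G H (b i)) (L i))"
  proof (intro SUP_cong refl)
    fix i j
    assume i: "i \<in> I" and j: "j \<in> I"
    let ?T = "TCC (G\<lparr>carrier := H\<rparr>) (conj_restrict G H (b i)) (L i)"
    have "(\<lambda>w. inv (b j) \<otimes> w \<otimes> b j) ` (?T #> b i)
        = (\<lambda>z. inv (b j) \<otimes> (z \<otimes> b i) \<otimes> b j) ` ?T"
      by (auto simp: r_coset_def)
    also have "\<dots> = (\<lambda>z. inv (b j) \<otimes> z \<otimes> (b i \<otimes> b j)) ` ?T"
      using TCC_sub[OF i] b[OF i] b[OF j] by (intro image_cong refl) (auto simp: m_assoc subset_iff)
    finally show "(\<lambda>w. inv (b j) \<otimes> w \<otimes> b j) `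
        {inv n \<otimes> t \<otimes> n | n t. n \<in> H \<and> t \<in> K \<inter> (H #> b i)}
        = (\<lambda>z. inv (b j) \<otimes> z \<otimes> (b i \<otimes> b j)) ` ?T"
      unfolding piece[OF i] .
  qed
  finally show ?thesis .
qed

theorem theorem4p6:
  fixes G :: "('a, 'c) monoid_scheme" (structure)
    and N K :: "'a set" and m :: nat and b :: "nat \<Rightarrow> 'a"
  assumes "finitely_presented G"
    and "N \<lhd> G"
    and "finite (rcosets N)"
    and "\<And>i. i \<in> {1..m} \<Longrightarrow> b i \<in> carrier G"
    and "carrier G = (\<Union>i\<in>{1..m}. N #> b i)"
    and "disjoint_family_on (\<lambda>i. N #> b i) {1..m}"
    and "K \<subseteq> carrier G"
    and "\<And>i \<phi>. i \<in> {1..m} \<Longrightarrow> \<phi> \<in> Via (G\<lparr>carrier := N\<rparr>) \<Longrightarrow>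
           separable (G\<lparr>carrier := N\<rparr>)
             (TCC (G\<lparr>carrier := N\<rparr>) \<phi> ((K \<inter> (N #> b i)) #> inv (b i)))"
  shows "separable G (conj_closure G K)"
proof -
  interpret normal N G
    by fact
  have "separable G ((\<lambda>z. inv (b j) \<otimes> z \<otimes> (b i \<otimes> b j)) `
      TCC (G\<lparr>carrier := N\<rparr>) (conj_restrict G N (b i)) ((K \<inter> (N #> b i)) #> inv (b i)))"
    if "i \<in> {1..m}" "j \<in> {1..m}" for i j
    using assms(4)[OF that(1)] assms(4)[OF that(2)]
    by (intro separable_translate separable_finite_index_subgroup[OF subgroup_axioms assms(3)]
        assms(8)[OF that(1)] conj_restrict_in_Via[OF assms(3)]) auto
  then have "separable G (\<Union>i\<in>{1..m}. \<Union>j\<in>{1..m}. (\<lambda>z. inv (b j) \<otimes> z \<otimes> (b i \<otimes> b j)) `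
      TCC (G\<lparr>carrier := N\<rparr>) (conj_restrict G N (b i)) ((K \<inter> (N #> b i)) #> inv (b i)))"
    unfolding separable_def
    by (intro closedin_Union finite_imageI finite_atLeastAtMost) (force intro!: closedin_Union)+
  moreover have "conj_closure G K
      = (\<Union>i\<in>{1..m}. \<Union>j\<in>{1..m}. (\<lambda>z. inv (b j) \<otimes> z \<otimes> (b i \<otimes> b j)) `
        TCC (G\<lparr>carrier := N\<rparr>) (conj_restrict G N (b i)) ((K \<inter> (N #> b i)) #> inv (b i)))"
    using assms(4) by (rule conj_closure_eq_Union_TCC[OF _ assms(5,7)])
  ultimately show ?thesis
    by simp
qed

end
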